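(* Let $U, V_1,\dots,V_p$, $A$, $R_i$, $R_i^*$, $f$, $u^0$, $\bm V$, $\bm B,\bm B_0$ be as in the context, with in particular $U=R_1^*V_1\oplus\dots\oplus R_p^*V_p$, $R_iR_i^*=I_i$ and $R_iR_j^*=0$ for $i\ne j$. Consider the two-level scheme $$\frac{\bm w^{n+1}-\bm w^n}{\tau}+\bm B_0\big(\sigma\bm w^{n+1}+(1-\sigma)\bm w^n\big)+(\bm B-\bm B_0)\bm w^n=\bm f^n,\quad n=0,\dots,N-1,\qquad \bm w^0=\bm v^0,$$ where $\sigma$ is a constant. The scheme has first order of approximation in $\tau$ (in the sense stated in the context). If $\sigma\ge\frac p2$, it is unconditionally stable; that is, for every time step $\tau>0$ (with $N\tau=T$), the approximate solution $y^n=\sum_{i=1}^pR_i^*w_i^n$ satisfies for all $n=0,\dots,N-1$ $$\|y^{n+1}\|_A^2\le\|u^0\|_A^2+\frac12\sum_{k=0}^n\tau\|f^k\|^2 .$$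
   Context: $U$ is a finite-dimensional real Hilbert space with scalar product $(\cdot,\cdot)$ and norm $\|\cdot\|$. $A:U\to U$ is a linear operator, independent of $t$, self-adjoint and positive definite ($A=A^*>0$); $\|u\|_A=(Au,u)^{1/2}$. The problem being approximated is the Cauchy problem $\frac{du}{dt}+Au=f(t)$, $0<t\le T$, $u(0)=u^0\in U$, with given $f:[0,T]\to U$. $V_1,\dots,V_p$ ($p\ge1$) are finite-dimensional real Hilbert spaces with scalar products $(\cdot,\cdot)_i$ and identity operators $I_i$; $R_i:U\to V_i$ are linear operators with adjoints $R_i^*:V_i\to U$. It is assumed that $U$ is the direct sum $U=R_1^*V_1\oplus\dots\oplus R_p^*V_p$, with $u=\sum_iR_i^*v_i$, $v_i=R_iu$, for each $u\in U$, so that $R_iR_i^*=I_i$ and $R_iR_j^*=0$ for $i\neq j$. $\bm V=V_1\oplus\dots\oplus V_p$ with scalar product $(\bm v,\bm z)=\sum_{i=1}^p(v_i,z_i)_i$ for $\bm v=\{v_1,\dots,v_p\}$, $\bm z=\{z_1,\dots,z_p\}$. On $\bm V$ define $$\bm B=\{R_iAR_j^*\}_{i,j=1}^p,\quad \bm B_0=\mathrm{diag}\{R_1AR_1^*,\dots,R_pAR_p^*\}.$$ Time grid: $t^n=n\tau$, $n=0,\dots,N$, $N\tau=T$; $f^n=f(t^n)$; $\bm f(t)=\{R_1f(t),\dots,R_pf(t)\}\in\bm V$, $\bm f^n=\bm f(t^n)$; $\bm v^0=\{R_1u^0,\dots,R_pu^0\}$. Components of $\bm w^n\in\bm V$ are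 denoted $w_i^n$. Order of approximation: the scheme has order of approximation $m$ in $\tau$ if, for every sufficiently smooth solution $\bm v$ of $\frac{d\bm v}{dt}+\bm B\bm v=\bm f$ on $[0,T]$, substituting $\bm v(t^k)$ for $\bm w^k$ in the difference equation gives a residual (left-hand side minus right-hand side) bounded in norm by $M\tau^m$ with $M$ independent of $\tau$ and $n$. *)

theory Defs
  imports "HOL-Analysis.Analysis"
begin

text \<open>
  The space U is a type of class \<open>real_inner\<close> spanned by a finite set. The spaces V i
  (i ranges over a finite type with p elements) are arbitrary subspaces of one Euclidean space,
  with the inherited scalar product; up to isometry every finite family of finite-dimensional real
  Hilbert spaces has this form. The direct sum of the V i is then a subspace of
  \<open>'v ^ 'p\<close>, whose library scalar product is the sum of the componentwise ones.
  An operator U -> V i is a linear map \<open>'u \<Rightarrow> 'v\<close> with values in V i; its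
  adjoint V i -> U is the restriction to V i of the library's \<open>adjoint\<close>.
\<close>

definition self_adjoint :: "('u::real_inner \<Rightarrow> 'u) \<Rightarrow> bool" where
  "self_adjoint A \<longleftrightarrow> linear A \<and> adjoint A = A"

definition positive_definite :: "('u::real_inner \<Rightarrow> 'u) \<Rightarrow> bool" where
  "positive_definite A \<longleftrightarrow> (\<forall>u. u \<noteq> 0 \<longrightarrow> A u \<bullet> u > 0)"

definition energy_norm :: "('u::real_inner \<Rightarrow> 'u) \<Rightarrow> 'u \<Rightarrow> real" where
  "energy_norm A u = sqrt (A u \<bullet> u)"

definition is_direct_sum :: "('p::finite \<Rightarrow> 'u::real_vector set) \<Rightarrow> bool" where
  "is_direct_sum X \<longleftrightarrow>
     (\<forall>i. subspace (X i)) \<and> (\<forall>u. \<exists>!x :: 'u ^ 'p. (\<forall>i. x $ i \<in> X i) \<and> u = (\<Sum>i\<in>UNIV. x $ i))"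

definition sum_space :: "('p::finite \<Rightarrow> 'v set) \<Rightarrow> ('v ^ 'p) set" where
  "sum_space V = {v. \<forall>i. v $ i \<in> V i}"

definition component_vec :: "('p::finite \<Rightarrow> 'u \<Rightarrow> 'v) \<Rightarrow> 'u \<Rightarrow> 'v ^ 'p" where
  "component_vec R u = (\<chi> i. R i u)"

definition assemble ::
  "('p::finite \<Rightarrow> 'u::real_inner \<Rightarrow> 'v::real_inner) \<Rightarrow> 'v ^ 'p \<Rightarrow> 'u" where
  "assemble R w = (\<Sum>i\<in>UNIV. adjoint (R i) (w $ i))"

definition B_op ::
  "('u::real_inner \<Rightarrow> 'u) \<Rightarrow> ('p::finite \<Rightarrow> 'u \<Rightarrow> 'v::real_inner) \<Rightarrow> 'v ^ 'p \<Rightarrow> 'v ^ 'p" where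
  "B_op A R w = (\<chi> i. \<Sum>j\<in>UNIV. R i (A (adjoint (R j) (w $ j))))"

definition B0_op ::
  "('u::real_inner \<Rightarrow> 'u) \<Rightarrow> ('p::finite \<Rightarrow> 'u \<Rightarrow> 'v::real_inner) \<Rightarrow> 'v ^ 'p \<Rightarrow> 'v ^ 'p" where
  "B0_op A R w = (\<chi> i. R i (A (adjoint (R i) (w $ i))))"

text \<open>Left-hand side minus right-hand side of the two-level scheme at level n.\<close>

definition scheme_residual ::
  "('u::real_inner \<Rightarrow> 'u) \<Rightarrow> ('p::finite \<Rightarrow> 'u \<Rightarrow> 'v::real_inner) \<Rightarrow> (real \<Rightarrow> 'u) \<Rightarrow> real \<Rightarrow>
   real \<Rightarrow> (nat \<Rightarrow> 'v ^ 'p) \<Rightarrow> nat \<Rightarrow> 'v ^ 'p" where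
  "scheme_residual A R f \<sigma> \<tau> w n =
     (1 / \<tau>) *\<^sub>R (w (Suc n) - w n)
     + B0_op A R (\<sigma> *\<^sub>R w (Suc n) + (1 - \<sigma>) *\<^sub>R w n)
     + (B_op A R (w n) - B0_op A R (w n))
     - component_vec R (f (real n * \<tau>))"

definition scheme_solution ::
  "('p::finite \<Rightarrow> 'v::real_inner set) \<Rightarrow> ('u::real_inner \<Rightarrow> 'u) \<Rightarrow> ('p \<Rightarrow> 'u \<Rightarrow> 'v) \<Rightarrow>
   (real \<Rightarrow> 'u) \<Rightarrow> 'u \<Rightarrow> real \<Rightarrow> real \<Rightarrow> nat \<Rightarrow> (nat \<Rightarrow> 'v ^ 'p) \<Rightarrow> bool" where
  "scheme_solution V A R f u0 \<sigma> \<tau> N w \<longleftrightarrow>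
     (\<forall>n\<le>N. w n \<in> sum_space V) \<and>
     w 0 = component_vec R u0 \<and>
     (\<forall>n<N. scheme_residual A R f \<sigma> \<tau> w n = 0)"

text \<open>k times continuously differentiable on [0,T], one-sidedly at the end points;
  D j is the j-th derivative.\<close>

definition Ck_on_interval :: "nat \<Rightarrow> real \<Rightarrow> (real \<Rightarrow> 'e::real_normed_vector) \<Rightarrow> bool" where
  "Ck_on_interval k T v \<longleftrightarrow>
     (\<exists>D :: nat \<Rightarrow> real \<Rightarrow> 'e.
        (\<forall>t\<in>{0..T}. D 0 t = v t) \<and>
        (\<forall>j<k. \<forall>t\<in>{0..T}. (D j has_vector_derivative D (Suc j) t) (at t within {0..T})) \<and>
        continuous_on {0..T} (D k))"

definition ode_solution ::
  "'e::real_normed_vector set \<Rightarrow> ('e \<Rightarrow> 'e) \<Rightarrow> (real \<Rightarrow> 'e) \<Rightarrow> real \<Rightarrow> (real \<Rightarrow> 'e) \<Rightarrow> bool" where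
  "ode_solution E B g T v \<longleftrightarrow>
     (\<forall>t\<in>{0..T}. v t \<in> E) \<and>
     (\<forall>t\<in>{0..T}. \<exists>v'. (v has_vector_derivative v') (at t within {0..T}) \<and> v' + B (v t) = g t)"

text \<open>
  Order of approximation m of a difference scheme for v' + B v = g in the space E, where
  \<open>res \<tau> w n\<close> is the residual of the difference equation at level n for the grid
  function w. ``Sufficiently smooth'' is m+1 times continuously differentiable.
  No initial condition is imposed on v, and M may depend on v.
\<close>

definition has_approximation_order ::
  "nat \<Rightarrow> 'e::real_normed_vector set \<Rightarrow> ('e \<Rightarrow> 'e) \<Rightarrow> (real \<Rightarrow> 'e) \<Rightarrow> real \<Rightarrow>
   (real \<Rightarrow> (nat \<Rightarrow> 'e) \<Rightarrow> nat \<Rightarrow> 'e) \<Rightarrow> bool" where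
  "has_approximation_order m E B g T res \<longleftrightarrow>
     (\<forall>v. Ck_on_interval (m + 1) T v \<and> ode_solution E B g T v \<longrightarrow>
        (\<exists>M. \<forall>\<tau> N n. \<tau> > 0 \<and> real N * \<tau> = T \<and> n < N \<longrightarrow>
           norm (res \<tau> (\<lambda>k. v (real k * \<tau>)) n) \<le> M * \<tau> ^ m))"

end

theory Submission
  imports Defs
begin

text \<open>
  With \<open>d = (w' - w) / \<tau>\<close> the scheme reads \<open>d + \<sigma> \<tau> B\<^sub>0 d + B w = f\<close>. Testing with d and assembling
  \<open>z = \<Sum>i. R\<^sub>i\<^sup>* d\<^sub>i = (y' - y) / \<tau>\<close>, the identity and B terms become \<open>\<parallel>z\<parallel>\<^sup>2\<close> and \<open>(A y, z)\<close>, while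
  Cauchy-Schwarz over the p summands gives \<open>p (B\<^sub>0 d, d) \<ge> (A z, z)\<close>. Since
  \<open>2 \<tau> (A y, z) = (A y', y') - (A y, y) - \<tau>\<^sup>2 (A z, z)\<close>, the condition \<open>\<sigma> \<ge> p / 2\<close> absorbs the negative
  term, and \<open>(f, z) \<le> \<parallel>z\<parallel>\<^sup>2 + \<parallel>f\<parallel>\<^sup>2 / 4\<close> closes the estimate.

  The residual of an exact solution is \<open>((v' - v) / \<tau> - v\<^sub>t) + \<sigma> B\<^sub>0 (v' - v)\<close>, and both terms are
  \<open>O(\<tau>)\<close> for twice continuously differentiable v.
\<close>

section \<open>Adjoints on finite-dimensional inner product spaces\<close>

text \<open>The library proves this only for \<open>euclidean_space\<close>; outside that class \<open>adjoint\<close> is a bare \<open>SOME\<close>.\<close>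

lemma adjoint_works_finite_span:
  fixes S :: "'a::real_inner set" and f :: "'a \<Rightarrow> 'b::real_inner"
  assumes "finite S" and "span S = UNIV" and f: "linear f"
  shows "f x \<bullet> y = x \<bullet> adjoint f y"
proof -
  obtain C where C: "finite C" "span C = span S" "pairwise orthogonal C"
    using basis_orthogonal[OF \<open>finite S\<close>] by blast
  have "\<exists>z. \<forall>x. f x \<bullet> y = x \<bullet> z" for y
  proof -
    \<comment> \<open>The Riesz representer of the functional \<open>f x \<bullet> y\<close>,
      written out in the orthogonal spanning set \<open>C\<close>; the set is not normalised, hence
      the division by \<open>c \<bullet> c\<close>.\<close>
    define z where "z = (\<Sum>c\<in>C. ((f c \<bullet> y) / (c \<bullet> c)) *\<^sub>R c)"
    have on_C: "f b \<bullet> y = b \<bullet> z" if "b \<in> C" for b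
    proof -
      have "b \<bullet> z = (\<Sum>c\<in>C. ((f c \<bullet> y) / (c \<bullet> c)) * (b \<bullet> c))"
        by (simp add: z_def inner_sum_right)
      also have "\<dots> = (\<Sum>c\<in>C. if c = b then ((f b \<bullet> y) / (b \<bullet> b)) * (b \<bullet> b) else 0)"
        using C(3) that by (intro sum.cong) (auto simp: pairwise_def orthogonal_def)
      \<comment> \<open>\<open>C\<close> may contain 0. There the quotient is 0 by the convention
        for division by zero, and \<open>f 0 \<bullet> y\<close> vanishes by linearity.\<close>
      also have "\<dots> = f b \<bullet> y"
        using that C(1) linear_0[OF f] by (cases "b = 0") simp_all
      finally show ?thesis by simp
    qed
    have lin: "linear (\<lambda>x. f x \<bullet> y)" "linear (\<lambda>x. x \<bullet> z)"
      using f by (auto simp: linear_iff inner_add_left)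
    have "f x \<bullet> y = x \<bullet> z" for x
      using linear_eq_on_span[OF lin on_C, where x = x] C(2) assms(2) by simp
    then show ?thesis by blast
  qed
  then obtain g where "\<And>y x. f x \<bullet> y = x \<bullet> g y"
    using choice[of "\<lambda>y z. \<forall>x. f x \<bullet> y = x \<bullet> z"] by blast
  then show ?thesis
    using adjoint_unique[of f g] by simp
qed

lemma adjoint_linear_finite_span:
  fixes S :: "'a::real_inner set" and f :: "'a \<Rightarrow> 'b::real_inner"
  assumes "finite S" and "span S = UNIV" and "linear f"
  shows "linear (adjoint f)"
proof (rule linearI)
  note adj = adjoint_works_finite_span[OF assms, symmetric]
  show "adjoint f (x + y) = adjoint f x + adjoint f y" for x y
    by (rule vector_eq_ldot[THEN iffD1]) (simp add: adj inner_add_right)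
  show "adjoint f (c *\<^sub>R x) = c *\<^sub>R adjoint f x" for c x
    by (rule vector_eq_ldot[THEN iffD1]) (simp add: adj)
qed

section \<open>Order of approximation\<close>

lemma vector_derivative_lipschitz:
  fixes g :: "real \<Rightarrow> 'e::real_normed_vector"
  assumes "\<And>t. t \<in> {a..b} \<Longrightarrow> (g has_vector_derivative g' t) (at t within {a..b})"
    and "\<And>t. t \<in> {a..b} \<Longrightarrow> norm (g' t) \<le> M"
    and "s \<in> {a..b}" and "t \<in> {a..b}"
  shows "norm (g t - g s) \<le> M * \<bar>t - s\<bar>"
proof -
  have "norm (g t - g s) \<le> M * norm (t - s)"
  proof (rule differentiable_bound[where S = "{a..b}" and f' = "\<lambda>t h. h *\<^sub>R g' t"])
    show "onorm (\<lambda>h. h *\<^sub>R g' x) \<le> M" if "x \<in> {a..b}" for x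
      using assms(2)[OF that] by (intro onorm_le) (simp add: mult_left_mono mult.commute[of M])
  qed (use assms in \<open>auto simp: has_vector_derivative_def\<close>)
  then show ?thesis by simp
qed

text \<open>The first two derivatives are continuous on a compact interval, hence bounded. The
  second bound is quantified over \<open>v'\<close> because the differential equation supplies its
  derivative only existentially.\<close>

lemma C2_taylor_bounds:
  fixes v :: "real \<Rightarrow> 'e::real_normed_vector"
  assumes "T > 0" and "Ck_on_interval 2 T v"
  obtains M where
    "\<And>t s. t \<in> {0..T} \<Longrightarrow> s \<in> {0..T} \<Longrightarrow> norm (v s - v t) \<le> M * \<bar>s - t\<bar>"
    "\<And>t s v'. t \<in> {0..T} \<Longrightarrow> s \<in> {0..T} \<Longrightarrow> (v has_vector_derivative v') (at t within {0..T}) \<Longrightarrow>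
       norm (v s - v t - (s - t) *\<^sub>R v') \<le> M * (s - t)\<^sup>2"
proof -
  obtain D where D0: "\<And>t. t \<in> {0..T} \<Longrightarrow> D 0 t = v t"
    and D: "\<And>j t. j < 2 \<Longrightarrow> t \<in> {0..T} \<Longrightarrow> (D j has_vector_derivative D (Suc j) t) (at t within {0..T})"
    and c2: "continuous_on {0..T} (D 2)"
    using assms(2) unfolding Ck_on_interval_def by blast
  have v: "(v has_vector_derivative D 1 t) (at t within {0..T})" if "t \<in> {0..T}" for t
    using D[of 0 t] that D0 by (auto intro: has_vector_derivative_transform[of t "{0..T}" v "D 0"])
  have D1: "(D 1 has_vector_derivative D 2 t) (at t within {0..T})" if "t \<in> {0..T}" for t
    using D[of 1 t] that by (simp add: numeral_2_eq_2)
  have c1: "continuous_on {0..T} (D 1)"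
    using D1 by (meson continuous_on_eq_continuous_within has_vector_derivative_continuous)
  have bdd: "\<exists>M. \<forall>t\<in>{0..T}. norm (g t) \<le> M" if "continuous_on {0..T} g" for g :: "real \<Rightarrow> 'e"
    using compact_imp_bounded[OF compact_continuous_image[OF that compact_Icc]]
    unfolding bounded_iff by blast
  obtain M1 M2 where M1: "\<And>t. t \<in> {0..T} \<Longrightarrow> norm (D 1 t) \<le> M1"
    and M2: "\<And>t. t \<in> {0..T} \<Longrightarrow> norm (D 2 t) \<le> M2"
    using bdd[OF c1] bdd[OF c2] by blast
  show ?thesis
  proof (rule that[of "max M1 M2"])
    fix t s assume ts: "t \<in> {0..T}" "s \<in> {0..T}"
    have "norm (v s - v t) \<le> M1 * \<bar>s - t\<bar>"
      using vector_derivative_lipschitz[OF v M1 ts] by simp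
    then show "norm (v s - v t) \<le> max M1 M2 * \<bar>s - t\<bar>"
      by (rule order_trans) (intro mult_right_mono, auto)
  next
    fix t s v' assume ts: "t \<in> {0..T}" "s \<in> {0..T}"
      and v': "(v has_vector_derivative v') (at t within {0..T})"
    have M2_nonneg: "M2 \<ge> 0"
      using M2[OF ts(1)] norm_ge_zero order_trans by blast
    \<comment> \<open>Derivatives within \<open>{0..T}\<close> are unique, even at the end points,
      because \<open>T > 0\<close> makes the interval nondegenerate.\<close>
    have eq: "v' = D 1 t"
      using vector_derivative_unique_within_closed_interval[of 0 T t v v' "D 1 t"] v' v ts assms(1)
      by simp
    have seg: "closed_segment t s \<subseteq> {0..T}"
      using ts by (auto simp: closed_segment_eq_real_ivl)
    \<comment> \<open>Mean value inequality for \<open>v\<close> minus its tangent at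
      \<open>t\<close>: its derivative \<open>D 1 x - D 1 t\<close> is at most
      \<open>M2 * \<bar>s - t\<bar>\<close> on the segment. This costs the Taylor factor 1/2, which
      is irrelevant for the order.\<close>
    have "norm (v s - v t - (s - t) *\<^sub>R D 1 t) \<le> norm (s - t) * (M2 * \<bar>s - t\<bar>)"
    proof (rule vector_differentiable_bound_linearization[where S = "closed_segment t s"])
      show "(v has_vector_derivative D 1 x) (at x within closed_segment t s)"
        if "x \<in> closed_segment t s" for x
        using v[of x] seg that has_vector_derivative_within_subset by blast
      fix x assume x: "x \<in> closed_segment t s"
      have "norm (D 1 x - D 1 t) \<le> M2 * \<bar>x - t\<bar>"
        using vector_derivative_lipschitz[OF D1 M2 ts(1)] x seg by blast
      also have "\<dots> \<le> M2 * \<bar>s - t\<bar>"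
        using x M2_nonneg by (intro mult_left_mono) (auto simp: closed_segment_eq_real_ivl split: if_splits)
      finally show "norm (D 1 x - D 1 t) \<le> M2 * \<bar>s - t\<bar>" .
    qed auto
    also have "\<dots> = M2 * (s - t)\<^sup>2"
      by (simp add: power2_eq_square flip: abs_mult)
    also have "\<dots> \<le> max M1 M2 * (s - t)\<^sup>2"
      by (intro mult_right_mono) auto
    finally show "norm (v s - v t - (s - t) *\<^sub>R v') \<le> max M1 M2 * (s - t)\<^sup>2"
      by (simp add: eq)
  qed
qed

lemma linear_B0_op:
  assumes "linear A" and "\<And>i. linear (R i)" and "\<And>i. linear (adjoint (R i))"
  shows "linear (B0_op A R)"
  by (rule linearI)
     (simp_all add: B0_op_def vec_eq_iff linear_add[OF assms(1)] linear_add[OF assms(2)]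
        linear_add[OF assms(3)] linear_scale[OF assms(1)] linear_scale[OF assms(2)]
        linear_scale[OF assms(3)])

text \<open>By linearity the weight \<sigma> acts only on the increment, and the explicit
  \<open>B0_op A R (w n)\<close> cancels. Both the approximation and the stability argument start
  from this form.\<close>

lemma scheme_residual_canonical:
  assumes "linear (B0_op A R)"
  shows "scheme_residual A R f \<sigma> \<tau> w n =
    (1 / \<tau>) *\<^sub>R (w (Suc n) - w n) + B_op A R (w n) - component_vec R (f (real n * \<tau>))
    + \<sigma> *\<^sub>R B0_op A R (w (Suc n) - w n)"
proof -
  have "\<sigma> *\<^sub>R w (Suc n) + (1 - \<sigma>) *\<^sub>R w n = w n + \<sigma> *\<^sub>R (w (Suc n) - w n)"
    by (simp add: algebra_simps)
  then show ?thesis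
    by (simp add: scheme_residual_def linear_add[OF assms] linear_scale[OF assms])
qed

lemma scheme_approximation_order:
  fixes A :: "'u::real_inner \<Rightarrow> 'u" and R :: "'p::finite \<Rightarrow> 'u \<Rightarrow> 'v::euclidean_space"
  assumes "T > 0" and lin: "linear (B0_op A R)"
  shows "has_approximation_order 1 E (B_op A R) (\<lambda>t. component_vec R (f t)) T
           (scheme_residual A R f \<sigma>)"
  unfolding has_approximation_order_def
proof (intro allI impI)
  fix v assume v: "Ck_on_interval (1 + 1) T v \<and> ode_solution E (B_op A R) (\<lambda>t. component_vec R (f t)) T v"
  then have "Ck_on_interval 2 T v" by (simp add: numeral_2_eq_2)
  then obtain M where
    M1: "\<And>t s. t \<in> {0..T} \<Longrightarrow> s \<in> {0..T} \<Longrightarrow> norm (v s - v t) \<le> M * \<bar>s - t\<bar>" and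
    M2: "\<And>t s v'. t \<in> {0..T} \<Longrightarrow> s \<in> {0..T} \<Longrightarrow> (v has_vector_derivative v') (at t within {0..T}) \<Longrightarrow>
       norm (v s - v t - (s - t) *\<^sub>R v') \<le> M * (s - t)\<^sup>2"
    using C2_taylor_bounds[OF \<open>T > 0\<close>] by blast
  obtain K where K: "K > 0" "\<And>x. norm (B0_op A R x) \<le> K * norm x"
    using linear_bounded_pos[OF lin] by blast
  show "\<exists>C. \<forall>\<tau> N n. \<tau> > 0 \<and> real N * \<tau> = T \<and> n < N \<longrightarrow>
     norm (scheme_residual A R f \<sigma> \<tau> (\<lambda>k. v (real k * \<tau>)) n) \<le> C * \<tau> ^ 1"
  proof (intro exI allI impI)
    fix \<tau> :: real and N n :: nat
    assume *: "\<tau> > 0 \<and> real N * \<tau> = T \<and> n < N"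
    define t s where "t = real n * \<tau>" and "s = real (Suc n) * \<tau>"
    have st: "s - t = \<tau>" by (simp add: s_def t_def algebra_simps)
    have "s \<le> real N * \<tau>"
      unfolding s_def using * by (intro mult_right_mono) auto
    then have ts: "t \<in> {0..T}" "s \<in> {0..T}"
      using * st by (auto simp: t_def s_def)
    obtain v' where v': "(v has_vector_derivative v') (at t within {0..T})"
      and ode: "v' + B_op A R (v t) = component_vec R (f t)"
      using v ts(1) unfolding ode_solution_def by blast
    \<comment> \<open>The differential equation at \<open>t\<close> turns
      \<open>B_op A R (v t) - component_vec R (f t)\<close> into \<open>- v'\<close>, so that only
      the error of the difference quotient and the \<sigma> term remain.\<close>
    have "scheme_residual A R f \<sigma> \<tau> (\<lambda>k. v (real k * \<tau>)) n
        = (1 / \<tau>) *\<^sub>R (v s - v t - (s - t) *\<^sub>R v') + \<sigma> *\<^sub>R B0_op A R (v s - v t)"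
      using * scheme_residual_canonical[OF lin, of f \<sigma> \<tau> "\<lambda>k. v (real k * \<tau>)" n, folded t_def s_def]
      by (simp add: st scaleR_diff_right flip: ode)
    also have "norm \<dots> \<le> (1 / \<tau>) * norm (v s - v t - (s - t) *\<^sub>R v') + \<bar>\<sigma>\<bar> * norm (B0_op A R (v s - v t))"
      using * by (intro order_trans[OF norm_triangle_ineq]) simp
    \<comment> \<open>The quadratic Taylor remainder loses one power of \<tau> to the quotient; the
      second term is already linear in \<tau>, \<open>K\<close> being the bound of the
      operator.\<close>
    also have "\<dots> \<le> (1 / \<tau>) * (M * \<tau>\<^sup>2) + \<bar>\<sigma>\<bar> * (K * (M * \<tau>))"
    proof (intro add_mono mult_left_mono)
      show "norm (v s - v t - (s - t) *\<^sub>R v') \<le> M * \<tau>\<^sup>2"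
        using M2[OF ts v'] st by simp
      have "norm (v s - v t) \<le> M * \<tau>"
        using M1[OF ts] st * by simp
      then show "norm (B0_op A R (v s - v t)) \<le> K * (M * \<tau>)"
        using K by (meson mult_left_mono less_imp_le order_trans)
    qed (use * in auto)
    also have "\<dots> = (M + \<bar>\<sigma>\<bar> * K * M) * \<tau> ^ 1"
      using * by (simp add: power2_eq_square field_simps)
    finally show "norm (scheme_residual A R f \<sigma> \<tau> (\<lambda>k. v (real k * \<tau>)) n)
        \<le> (M + \<bar>\<sigma>\<bar> * K * M) * \<tau> ^ 1" .
  qed
qed

section \<open>Stability\<close>

text \<open>Nonnegativity at \<open>a - b\<close> bounds each cross term by the mean of two diagonal
  ones, and over all ordered pairs every diagonal term occurs \<open>2 * card I\<close> times. With
  one summand per component, this factor is the source of the threshold p/2.\<close>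

lemma quadratic_form_sum_le:
  fixes A :: "'u::real_inner \<Rightarrow> 'u" and x :: "'p \<Rightarrow> 'u"
  assumes "linear A" and sym: "\<And>x y. A x \<bullet> y = x \<bullet> A y" and pos: "\<And>x. A x \<bullet> x \<ge> 0"
    and "finite I"
  shows "A (\<Sum>i\<in>I. x i) \<bullet> (\<Sum>i\<in>I. x i) \<le> real (card I) * (\<Sum>i\<in>I. A (x i) \<bullet> x i)"
proof -
  let ?q = "\<lambda>x. A x \<bullet> x"
  have cross: "2 * (A a \<bullet> b) \<le> ?q a + ?q b" for a b
    using pos[of "a - b"] sym[of a b]
    by (simp add: linear_diff[OF assms(1)] inner_diff_left inner_diff_right inner_commute)
  have "?q (\<Sum>i\<in>I. x i) = (\<Sum>i\<in>I. \<Sum>j\<in>I. A (x i) \<bullet> x j)"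
    by (simp add: linear_sum[OF assms(1)] inner_sum_left) (simp add: inner_sum_right)
  then have "2 * ?q (\<Sum>i\<in>I. x i) = (\<Sum>i\<in>I. \<Sum>j\<in>I. 2 * (A (x i) \<bullet> x j))"
    by (simp add: sum_distrib_left)
  also have "\<dots> \<le> (\<Sum>i\<in>I. \<Sum>j\<in>I. ?q (x i) + ?q (x j))"
    by (intro sum_mono cross)
  also have "\<dots> = 2 * (real (card I) * (\<Sum>i\<in>I. ?q (x i)))"
    by (simp add: sum.distrib sum_distrib_left)
  finally show ?thesis by simp
qed

theorem theorem3:
  fixes A :: "'u::real_inner \<Rightarrow> 'u"
    and V :: "'p::finite \<Rightarrow> 'v::euclidean_space set"
    and R :: "'p \<Rightarrow> 'u \<Rightarrow> 'v"
    and f :: "real \<Rightarrow> 'u" and u0 :: 'u and T \<sigma> :: real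
  assumes U_fin_dim: "\<exists>S :: 'u set. finite S \<and> span S = UNIV"
    and A_self_adjoint: "self_adjoint A"
    and A_positive: "positive_definite A"
    and V_subspace: "\<And>i. subspace (V i)"
    and R_linear: "\<And>i. linear (R i)"
    and R_into: "\<And>i. range (R i) \<subseteq> V i"
    and U_direct_sum: "is_direct_sum (\<lambda>i. adjoint (R i) ` V i)"
    and U_decomposition: "\<And>u. u = (\<Sum>i\<in>UNIV. adjoint (R i) (R i u))"
    and R_identity: "\<And>i v. v \<in> V i \<Longrightarrow> R i (adjoint (R i) v) = v"
    and R_orthogonal: "\<And>i j v. i \<noteq> j \<Longrightarrow> v \<in> V j \<Longrightarrow> R i (adjoint (R j) v) = 0"
    and T_pos: "T > 0"
  shows "has_approximation_order 1 (sum_space V) (B_op A R) (\<lambda>t. component_vec R (f t)) T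
           (scheme_residual A R f \<sigma>) \<and>
         (\<sigma> \<ge> real CARD('p) / 2 \<longrightarrow>
           (\<forall>\<tau> N w. \<tau> > 0 \<and> real N * \<tau> = T \<and> scheme_solution V A R f u0 \<sigma> \<tau> N w \<longrightarrow>
             (\<forall>n<N. (energy_norm A (assemble R (w (Suc n))))\<^sup>2
                      \<le> (energy_norm A u0)\<^sup>2 + 1/2 * (\<Sum>k=0..n. \<tau> * (norm (f (real k * \<tau>)))\<^sup>2))))"
proof -
  obtain S :: "'u set" where S: "finite S" "span S = UNIV"
    using U_fin_dim by blast
  have A_lin: "linear A" and A_adj: "adjoint A = A"
    using A_self_adjoint by (auto simp: self_adjoint_def)
  have A_sym: "A x \<bullet> y = x \<bullet> A y" for x y
    using adjoint_works_finite_span[OF S A_lin] A_adj by simp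
  have A_nonneg: "A x \<bullet> x \<ge> 0" for x
    using A_positive by (cases "x = 0") (auto simp: positive_definite_def intro: less_imp_le)
  have R_adj: "R i x \<bullet> y = x \<bullet> adjoint (R i) y" for i x y
    by (rule adjoint_works_finite_span[OF S R_linear])
  have adj_lin: "linear (adjoint (R i))" for i
    by (rule adjoint_linear_finite_span[OF S R_linear])
  have B0_lin: "linear (B0_op A R)"
    by (rule linear_B0_op[OF A_lin R_linear adj_lin])
  have asm_lin: "linear (assemble R)"
    by (rule linearI)
       (simp_all add: assemble_def linear_add[OF adj_lin] linear_scale[OF adj_lin]
          sum.distrib scaleR_sum_right)
  have energy: "(energy_norm A x)\<^sup>2 = A x \<bullet> x" for x
    by (simp add: energy_norm_def A_nonneg)
  \<comment> \<open>\<open>assemble R\<close> is the adjoint of \<open>component_vec R\<close>;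
    together with \<open>B_eq\<close> this moves the tested equation from the direct sum into
    U.\<close>
  have test_component: "component_vec R u \<bullet> d = u \<bullet> assemble R d" for u d
    by (simp add: component_vec_def assemble_def inner_vec_def R_adj inner_sum_right)
  have B_eq: "B_op A R w = component_vec R (A (assemble R w))" for w
    by (simp add: B_op_def component_vec_def assemble_def linear_sum[OF A_lin] linear_sum[OF R_linear])
  \<comment> \<open>On \<open>sum_space V\<close> the map \<open>component_vec R\<close> inverts its
    adjoint \<open>assemble R\<close>, which is therefore an isometry there.\<close>
  have norm_assemble: "assemble R d \<bullet> assemble R d = d \<bullet> d" if "d \<in> sum_space V" for d
  proof -
    have "R i (assemble R d) = d $ i" for i
    proof -
      have "R i (assemble R d) = (\<Sum>j\<in>UNIV. R i (adjoint (R j) (d $ j)))"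
        by (simp add: assemble_def linear_sum[OF R_linear])
      also have "\<dots> = (\<Sum>j\<in>UNIV. if j = i then d $ i else 0)"
        using that R_identity R_orthogonal by (intro sum.cong) (auto simp: sum_space_def)
      finally show ?thesis by simp
    qed
    then have "component_vec R (assemble R d) = d"
      by (simp add: component_vec_def vec_eq_iff)
    then show ?thesis using test_component[of "assemble R d" d] by simp
  qed
  have B0_ge: "A (assemble R d) \<bullet> assemble R d \<le> real CARD('p) * (B0_op A R d \<bullet> d)" for d
    using quadratic_form_sum_le[OF A_lin A_sym A_nonneg, of UNIV "\<lambda>i. adjoint (R i) (d $ i)"]
    by (simp add: B0_op_def assemble_def inner_vec_def R_adj)
  have step: "A (assemble R w') \<bullet> assemble R w'
      \<le> A (assemble R w) \<bullet> assemble R w + 1/2 * (\<tau> * (norm g)\<^sup>2)"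
    if \<sigma>: "\<sigma> \<ge> real CARD('p) / 2" and \<tau>: "\<tau> > 0" and w: "w \<in> sum_space V" "w' \<in> sum_space V"
      and eq: "(1 / \<tau>) *\<^sub>R (w' - w) + B_op A R w - component_vec R g + \<sigma> *\<^sub>R B0_op A R (w' - w) = 0"
    for \<tau> w w' g
  proof -
    define d where "d = (1 / \<tau>) *\<^sub>R (w' - w)"
    define y z where "y = assemble R w" and "z = assemble R d"
    have w': "w' = w + \<tau> *\<^sub>R d" using \<tau> by (simp add: d_def)
    have d_in: "d \<in> sum_space V"
      using w V_subspace by (simp add: d_def sum_space_def subspace_diff subspace_scale)
    have y': "assemble R w' = y + \<tau> *\<^sub>R z"
      by (simp add: w' y_def z_def linear_add[OF asm_lin] linear_scale[OF asm_lin])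
    have "d + B_op A R w - component_vec R g + (\<sigma> * \<tau>) *\<^sub>R B0_op A R d = 0"
      using eq \<tau> by (simp add: w' linear_scale[OF B0_lin])
    then have "(d + B_op A R w - component_vec R g + (\<sigma> * \<tau>) *\<^sub>R B0_op A R d) \<bullet> d = 0"
      by simp
    then have tested: "z \<bullet> z + A y \<bullet> z - g \<bullet> z + \<sigma> * \<tau> * (B0_op A R d \<bullet> d) = 0"
      using norm_assemble[OF d_in]
      by (simp add: inner_add_left inner_diff_left B_eq test_component y_def z_def)
    have B0_nonneg: "B0_op A R d \<bullet> d \<ge> 0"
      using A_nonneg by (simp add: B0_op_def inner_vec_def R_adj sum_nonneg)
    \<comment> \<open>Here the condition on \<sigma> enters: it gives p/2 times the
      \<open>B0_op\<close> form, and \<open>B0_ge\<close> trades the factor p for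
      \<open>A z \<bullet> z\<close>.\<close>
    have "A z \<bullet> z / 2 \<le> \<sigma> * (B0_op A R d \<bullet> d)"
      using B0_ge[of d] mult_right_mono[OF \<sigma> B0_nonneg] by (simp add: z_def)
    then have "\<tau> * (A z \<bullet> z / 2) \<le> \<tau> * (\<sigma> * (B0_op A R d \<bullet> d))"
      using \<tau> by (intro mult_left_mono) auto
    \<comment> \<open>Completing the square with \<open>g / 2\<close> gives
      \<open>z \<bullet> z\<close> the coefficient 1, so that it cancels exactly against the
      identity term of the tested equation.\<close>
    moreover have "g \<bullet> z \<le> z \<bullet> z + (norm g)\<^sup>2 / 4"
      using inner_ge_zero[of "z - (1/2) *\<^sub>R g"]
      by (simp add: inner_diff_left inner_diff_right inner_commute power2_norm_eq_inner)
    ultimately have "A y \<bullet> z + \<tau> * (A z \<bullet> z / 2) \<le> (norm g)\<^sup>2 / 4"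
      using tested by (simp add: mult_ac)
    \<comment> \<open>The factor \<open>2 * \<tau>\<close> makes the left side the energy increment
      over one step and turns 1/4 into the final 1/2.\<close>
    then have "(2 * \<tau>) * (A y \<bullet> z + \<tau> * (A z \<bullet> z / 2)) \<le> (2 * \<tau>) * ((norm g)\<^sup>2 / 4)"
      using \<tau> by (intro mult_left_mono) auto
    moreover have "A (y + \<tau> *\<^sub>R z) \<bullet> (y + \<tau> *\<^sub>R z) = A y \<bullet> y + (2 * \<tau>) * (A y \<bullet> z + \<tau> * (A z \<bullet> z / 2))"
      using A_sym[of y z]
      by (simp add: linear_add[OF A_lin] linear_scale[OF A_lin] inner_add_left inner_add_right
            inner_commute algebra_simps)
    ultimately show ?thesis by (simp add: y' flip: y_def)
  qed
  have stability: "(energy_norm A (assemble R (w (Suc n))))\<^sup>2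
      \<le> (energy_norm A u0)\<^sup>2 + 1/2 * (\<Sum>k=0..n. \<tau> * (norm (f (real k * \<tau>)))\<^sup>2)"
    if \<sigma>: "\<sigma> \<ge> real CARD('p) / 2" and \<tau>: "\<tau> > 0" and sol: "scheme_solution V A R f u0 \<sigma> \<tau> N w"
      and "n < N" for \<tau> N w n
    using \<open>n < N\<close>
  proof (induction n)
    have w_step: "(energy_norm A (assemble R (w (Suc n))))\<^sup>2
        \<le> (energy_norm A (assemble R (w n)))\<^sup>2 + 1/2 * (\<tau> * (norm (f (real n * \<tau>)))\<^sup>2)"
      if "n < N" for n
      unfolding energy using sol that scheme_residual_canonical[OF B0_lin, of f \<sigma> \<tau> w n]
      by (intro step[OF \<sigma> \<tau>]) (auto simp: scheme_solution_def)
    {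
      case 0
      \<comment> \<open>The sum up to \<open>n\<close> bounds the energy at level
        \<open>Suc n\<close>, so the base case already takes one step, starting from
        \<open>u0\<close>.\<close>
      have "assemble R (w 0) = u0"
        using sol U_decomposition[of u0]
        by (simp add: scheme_solution_def assemble_def component_vec_def)
      then show ?case using w_step[OF 0] by simp
    next
      case (Suc n)
      then show ?case using w_step[of "Suc n"] by (simp add: algebra_simps)
    }
  qed
  show ?thesis
    using scheme_approximation_order[OF T_pos B0_lin] stability by blast
qed

end
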